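(* Let $n\ge 1$, let $\pi\in\mathcal{C}_{n+1}$ and let $\sigma=\varphi(\pi)$, where $\varphi:\mathcal{C}_{n+1}\to\mathcal{S}_n$ is the map defined by the algorithm in the context. Then (1) $\pi^{-1}(n+1)=\sigma^{-1}(n)$; (2) $E(\pi)=E(\sigma)$.
   Context: $[n]=\{1,\dots,n\}$; $\mathcal{S}_n$ is the set of permutations of $[n]$; $\mathcal{C}_{n+1}\subseteq\mathcal{S}_{n+1}$ is the set of permutations consisting of a single $(n+1)$-cycle. For $\tau\in\mathcal{S}_m$, the set of weak excedances is $E(\tau)=\{i : 1\le i\le m,\ \tau(i)\ge i\}$. The map $\varphi:\mathcal{C}_{n+1}\to\mathcal{S}_n$ is defined as follows. Given $\pi\in\mathcal{C}_{n+1}$, write $\pi=(t_1,\dots,t_n,n+1)$ in cycle notation with $n+1$ last. Let $t_1=t_{i_1}<t_{i_2}<\dots<t_{i_r}<t_{i_{r+1}}=n+1$ be the left-to-right maxima of the sequence $t_1,\dots,t_n,n+1$, put $a_j=t_{i_j}$ and $b_j=t_{i_{j+1}-1}$ for $1\le j\le r$, and start with $\tilde\sigma=\Gamma_1\Gamma_2\cdots\Gamma_r$, where $\Gamma_j=(t_{i_j},t_{i_j+1},\dots,t_{i_{j+1}-1})=(a_j,\dots,b_j)$. The written cycle form is modified by switches: switching $u$ and $v$ means interchanging the positions of the values $u$ and $v$ in the written cycle form, leaving everything else in place. At any time $\tilde\sigma$ denotes the current permutation and $\Gamma_j$ its current $j$-th written cycle (cycles are never rotated or reordered); leftmost, rightmost,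 first and last refer to this written form, and $s$ precedes $t$ if $s$ is immediately to the left of $t$ in the same written cycle. $P(x,y)$ is the condition that $1\le x,y\le n$, $\pi(x)>\pi(y)$ and $\tilde\sigma(x)<\tilde\sigma(y)$ (for the current $\tilde\sigma$). For $i=1,2,\dots,r-1$ in this order, perform iteration $i$: let $z$ be the rightmost entry of $\Gamma_i$. If neither $P(z,z+1)$ nor $P(z,z-1)$ holds, do nothing. Otherwise let $\varepsilon\in\{-1,1\}$ be such that $P(z,z+\varepsilon)$ holds and $\tilde\sigma(z+\varepsilon)$ is largest, and, for as long as $P(z,z+\varepsilon)$ holds, repeat: (I) switch $z$ and $z+\varepsilon$; (II) if the last switch did not involve the leftmost entry of $\Gamma_i$, let $x$ and $y$ be the elements preceding the two just-switched entries; if $|x-y|=1$, switch $x$ and $y$ and repeat (II) (if one of the just-switched entries has no preceding element, (II) makes no switch); (III) replace $z$ by $z+\varepsilon$, the new rightmost entry of $\Gamma_i$. The final $\tilde\sigma$ is $\varphi(\pi)$. *)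

theory Defs
  imports
    "HOL-Combinatorics.Cycles"
    "HOL-Library.While_Combinator"
    "HOL-Library.Sublist"
begin

text \<open>
  Permutations of \<open>{1..m}\<close> are functions on \<^typ>\<open>nat\<close> that fix everything outside
  \<open>{1..m}\<close>, as in \<open>p permutes {1..m}\<close>.
\<close>

definition cyclic_perms :: "nat \<Rightarrow> (nat \<Rightarrow> nat) set" where
  "cyclic_perms m =
     {p. p permutes {1..m} \<and> (\<exists>cs. cycle cs \<and> set cs = {1..m} \<and> p = cycle_of_list cs)}"

definition weak_excedances :: "nat \<Rightarrow> (nat \<Rightarrow> nat) \<Rightarrow> nat set" where
  "weak_excedances m p = {i. 1 \<le> i \<and> i \<le> m \<and> p i \<ge> i}"


subsection \<open>Written cycle forms\<close>

text \<open>
  A written cycle form is the list of its written cycles; list indices start at 0, so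
  \<open>\<Gamma>\<^sub>j\<close> is \<open>W ! (j - 1)\<close>.
\<close>

definition perm_of :: "nat list list \<Rightarrow> nat \<Rightarrow> nat" where
  "perm_of W = foldr (\<circ>) (map cycle_of_list W) id"

definition switch :: "nat \<Rightarrow> nat \<Rightarrow> nat list list \<Rightarrow> nat list list" where
  "switch u v W = map (map (Transposition.transpose u v)) W"

definition precedes :: "nat list list \<Rightarrow> nat \<Rightarrow> nat \<Rightarrow> bool" where
  "precedes W s t \<longleftrightarrow> (\<exists>c\<in>set W. sublist [s, t] c)"

text \<open>The word \<open>t\<^sub>1, \<dots>, t\<^sub>m\<close> such that \<open>p = (t\<^sub>1, \<dots>, t\<^sub>m)\<close> in cycle notation and \<open>t\<^sub>m = m\<close>.\<close>

definition cycle_word :: "nat \<Rightarrow> (nat \<Rightarrow> nat) \<Rightarrow> nat list" where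
  "cycle_word m p = map (\<lambda>k. (p ^^ k) m) [1..<m + 1]"

lemma cycle_word:
  assumes "p \<in> cyclic_perms m" and "m \<ge> 1"
  shows "cycle (cycle_word m p)" "set (cycle_word m p) = {1..m}"
    "last (cycle_word m p) = m" "cycle_of_list (cycle_word m p) = p"
proof -
  obtain cs where cs: "cycle cs" "set cs = {1..m}" "p = cycle_of_list cs"
    using assms(1) by (auto simp: cyclic_perms_def)
  have len: "length cs = m"
    using distinct_card[OF cs(1)] cs(2) by simp
  obtain j where j: "j < m" "cs ! j = m"
    using assms(2) cs(2) len by (metis atLeastAtMost_iff in_set_conv_nth le_refl)
  have pow: "(p ^^ k) m = cs ! ((j + k) mod m)" for k
  proof -
    have "map (p ^^ k) cs ! j = rotate k cs ! j"
      using cyclic_rotation[OF cs(1)] cs(3) by simp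
    then show ?thesis
      using j len by (simp add: nth_rotate add.commute)
  qed
  have "cycle_word m p = rotate (Suc j) cs"
  proof (rule nth_equalityI)
    show "length (cycle_word m p) = length (rotate (Suc j) cs)"
      by (simp add: cycle_word_def len)
  next
    fix i assume "i < length (cycle_word m p)"
    then have i: "i < m" by (simp add: cycle_word_def del: upt_Suc)
    have "cycle_word m p ! i = (p ^^ Suc i) m"
      unfolding cycle_word_def using i by (simp del: upt_Suc funpow.simps)
    also have "\<dots> = rotate (Suc j) cs ! i"
      using i len by (simp add: pow nth_rotate del: rotate_Suc funpow.simps)
    finally show "cycle_word m p ! i = rotate (Suc j) cs ! i" .
  qed
  then show "cycle (cycle_word m p)" "set (cycle_word m p) = {1..m}"
    "cycle_of_list (cycle_word m p) = p"
    using cs cycle_of_list_rotate_independent[OF cs(1)] by (simp_all del: rotate_Suc)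
  have "(p ^^ m) m = m"
    using cycle_is_id_root[OF cs(1)] cs(3) len by simp
  then show "last (cycle_word m p) = m"
    using assms(2) by (simp add: cycle_word_def)
qed

definition lr_maxima :: "nat list \<Rightarrow> nat list" where
  "lr_maxima t = [k \<leftarrow> [0..<length t]. \<forall>j<k. t ! j < t ! k]"

text \<open>
  The blocks between consecutive left-to-right maxima. The last left-to-right maximum of
  \<open>t\<^sub>1, \<dots>, t\<^sub>n, n + 1\<close> is the final entry \<open>n + 1\<close>, which belongs to no block.
\<close>

definition initial_form :: "nat \<Rightarrow> (nat \<Rightarrow> nat) \<Rightarrow> nat list list" where
  "initial_form n p =
     (let t = cycle_word (n + 1) p; ks = lr_maxima t
      in map (\<lambda>j. map ((!) t) [ks ! j..<ks ! Suc j]) [0..<length ks - 1])"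


subsection \<open>The algorithm\<close>

definition cond_P :: "nat \<Rightarrow> (nat \<Rightarrow> nat) \<Rightarrow> nat list list \<Rightarrow> nat \<Rightarrow> nat \<Rightarrow> bool" where
  "cond_P n p W x y \<longleftrightarrow>
     1 \<le> x \<and> x \<le> n \<and> 1 \<le> y \<and> y \<le> n \<and> p x > p y \<and> perm_of W x < perm_of W y"

text \<open>For \<open>z = 1\<close> and \<open>\<epsilon> = -1\<close> this gives 0, which the range condition in \<^const>\<open>cond_P\<close> excludes.\<close>

definition shift :: "nat \<Rightarrow> int \<Rightarrow> nat" where
  "shift z \<epsilon> = nat (int z + \<epsilon>)"

text \<open>
  Step (II) for the block with index \<open>i\<close>. The state consists of the form and the two
  entries that were switched last. A predecessor is unique, since the entries of a form
  are distinct, and it lies strictly further to the left, so the loop terminates.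
\<close>

definition switch_preceding ::
  "nat \<Rightarrow> nat list list \<times> nat \<times> nat \<Rightarrow> nat list list \<times> nat \<times> nat" where
  "switch_preceding i =
     while
       (\<lambda>(W, u, v). hd (W ! i) \<notin> {u, v} \<and>
          (\<exists>x y. precedes W x u \<and> precedes W y v \<and> \<bar>int x - int y\<bar> = 1))
       (\<lambda>(W, u, v).
          let x = (THE x. precedes W x u); y = (THE y. precedes W y v)
          in (switch x y W, x, y))"

text \<open>
  The loop over (I)--(III). It terminates because \<open>z\<close> moves in the fixed direction \<open>\<epsilon>\<close> and
  \<^const>\<open>cond_P\<close> keeps it in \<open>{1..n}\<close>.
\<close>

definition switch_loop ::
  "nat \<Rightarrow> (nat \<Rightarrow> nat) \<Rightarrow> nat \<Rightarrow> int \<Rightarrow> nat list list \<times> nat \<Rightarrow> nat list list \<times> nat" where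
  "switch_loop n p i \<epsilon> =
     while
       (\<lambda>(W, z). cond_P n p W z (shift z \<epsilon>))
       (\<lambda>(W, z).
          let z' = shift z \<epsilon>
          in (fst (switch_preceding i (switch z z' W, z, z')), z'))"

definition iteration ::
  "nat \<Rightarrow> (nat \<Rightarrow> nat) \<Rightarrow> nat \<Rightarrow> nat list list \<Rightarrow> nat list list" where
  "iteration n p i W =
     (let z = last (W ! i) in
      if \<not> cond_P n p W z (z + 1) \<and> \<not> cond_P n p W z (z - 1) then W
      else
        let \<epsilon> = arg_max (\<lambda>\<epsilon>. perm_of W (shift z \<epsilon>)) (\<lambda>\<epsilon>. \<epsilon> \<in> {-1, 1} \<and> cond_P n p W z (shift z \<epsilon>))
        in fst (switch_loop n p i \<epsilon> (W, z)))"

text \<open>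
  The number \<open>r\<close> of blocks never changes; iterations \<open>1, \<dots>, r - 1\<close> have block indices
  \<open>0, \<dots>, r - 2\<close>.
\<close>

definition \<phi> :: "nat \<Rightarrow> (nat \<Rightarrow> nat) \<Rightarrow> nat \<Rightarrow> nat" where
  "\<phi> n p =
     (let W = initial_form n p
      in perm_of (fold (iteration n p) [0..<length W - 1] W))"

end

theory Submission
  imports Defs
begin

text \<open>
  In \<open>initial_form n \<pi>\<close> the first entry of each block is its maximum. Hence every entry \<open>x\<close> that
  ends a block is a weak excedance of both permutations (\<open>x\<close> goes to the first entry of its block,
  resp. to the next left-to-right maximum), and \<open>\<beta> = inv \<pi> (n + 1)\<close>, which ends the last block,
  is sent to \<open>n\<close>.

  A switch conjugates by a transposition of two adjacent values, and the switched values always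
  lie in different blocks, so the first entry of each block stays maximal. For (I), with
  \<open>f\<close> the current permutation, \<open>f z\<close> is the first entry of block \<open>i\<close>, and
  \<open>f z < f z'\<close> puts \<open>z'\<close> into another block; as \<open>z \<le> f z < f z'\<close>,
  both entries remain weak excedances. For (II), the images of \<open>x\<close> and \<open>y\<close> are adjacent and
  distinct from \<open>x\<close> and \<open>y\<close>, so exchanging them changes no weak excedance. Finally \<open>\<pi> z' < \<pi> z\<close>
  excludes \<open>z' = \<beta>\<close>, so \<open>f z < f z' < n\<close>: block \<open>i\<close> has no entry as large as \<open>n - 1\<close>, and
  neither \<open>n\<close> nor \<open>\<beta>\<close> is ever switched.
\<close>

section \<open>Forms and conjugation\<close>

lemma cycle_of_list_consecutive:
  assumes "distinct (ps @ [s, t] @ ss)"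
  shows "cycle_of_list (ps @ [s, t] @ ss) s = t"
proof -
  let ?c = "ps @ [s, t] @ ss"
  have "map (cycle_of_list ?c) ?c ! length ps = rotate1 ?c ! length ps"
    using cyclic_rotation[of ?c 1] assms by simp
  then show ?thesis
    by (cases ps) (simp_all add: nth_append)
qed

lemma cycle_of_list_last:
  assumes "distinct c" "c \<noteq> []"
  shows "cycle_of_list c (last c) = hd c"
proof -
  have "map (cycle_of_list c) c = rotate1 c"
    using cyclic_rotation[of c 1] assms by simp
  then have "last (map (cycle_of_list c) c) = last (rotate1 c)"
    by simp
  then show ?thesis
    using assms(2) by (cases c) (simp_all add: last_map del: list.map)
qed

lemma perm_of_Cons: "perm_of (c # W) = cycle_of_list c \<circ> perm_of W"
  by (simp add: perm_of_def)

lemma perm_of_outside: "x \<notin> set (concat W) \<Longrightarrow> perm_of W x = x"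
  by (induction W) (auto simp: perm_of_Cons perm_of_def id_outside_supp)

lemma cycle_of_list_in: "x \<in> set c \<Longrightarrow> cycle_of_list c x \<in> set c"
  by (simp add: permutes_in_image[OF cycle_permutes])

text \<open>The blocks are disjoint, so every other factor of the product fixes both
  \<open>x\<close> and its image in \<open>c\<close>.\<close>

lemma perm_of_eq_cycle_of_list:
  assumes "distinct (concat W)" "c \<in> set W" "x \<in> set c"
  shows "perm_of W x = cycle_of_list c x"
  using assms
proof (induction W)
  case (Cons d W)
  show ?case
  proof (cases "x \<in> set d")
    case True
    then have "d = c" "x \<notin> set (concat W)"
      using Cons.prems by auto
    then show ?thesis
      by (simp add: perm_of_Cons perm_of_outside)
  next
    case False
    then have c: "c \<in> set W" using Cons.prems by auto
    then have "perm_of W x = cycle_of_list c x"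
      using Cons by simp
    moreover have "cycle_of_list c x \<notin> set d"
      using cycle_of_list_in[OF Cons.prems(3)] Cons.prems(1) c by auto
    ultimately show ?thesis
      by (simp add: perm_of_Cons id_outside_supp)
  qed
qed simp

lemma perm_of_in:
  "distinct (concat W) \<Longrightarrow> c \<in> set W \<Longrightarrow> x \<in> set c \<Longrightarrow> perm_of W x \<in> set c"
  by (simp add: perm_of_eq_cycle_of_list cycle_of_list_in)

lemma distinct_concat_member: "distinct (concat W) \<Longrightarrow> c \<in> set W \<Longrightarrow> distinct c"
  by (induction W) auto

lemma perm_of_consecutive:
  assumes "distinct (concat W)" "ps @ [s, t] @ ss \<in> set W"
  shows "perm_of W s = t"
  using perm_of_eq_cycle_of_list[OF assms, of s]
    cycle_of_list_consecutive[OF distinct_concat_member[OF assms]] by simp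

lemma perm_of_precedes:
  "distinct (concat W) \<Longrightarrow> precedes W s t \<Longrightarrow> perm_of W s = t"
  unfolding precedes_def sublist_def using perm_of_consecutive by blast

lemma perm_of_last:
  assumes "distinct (concat W)" "c \<in> set W" "c \<noteq> []"
  shows "perm_of W (last c) = hd c"
  using perm_of_eq_cycle_of_list[OF assms(1,2)] distinct_concat_member[OF assms(1,2)]
    cycle_of_list_last assms(3) by simp

lemma perm_of_permutes: "perm_of W permutes set (concat W)"
proof (induction W)
  case (Cons c W)
  show ?case unfolding perm_of_Cons
    by (rule permutes_compose)
      (auto intro: permutes_subset[OF Cons.IH] permutes_subset[OF cycle_permutes])
qed (simp add: perm_of_def permutes_id flip: id_def)

text \<open>In the product of the conjugated cycles each inner \<open>inv q\<close> cancels against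
  the next \<open>q\<close>. A switch is the case where \<open>q\<close> is a transposition.\<close>

lemma perm_of_map_conj:
  assumes "distinct (concat W)" "bij q"
  shows "perm_of (map (map q) W) = q \<circ> perm_of W \<circ> inv q"
  using assms(1)
proof (induction W)
  case Nil
  then show ?case
    using assms(2) by (simp add: perm_of_def fun_eq_iff bij_is_surj surj_f_inv_f)
next
  case (Cons c W)
  have "inv q (q x) = x" for x
    using assms(2) by (simp add: bij_is_inj)
  moreover have "cycle_of_list (map q c) = q \<circ> cycle_of_list c \<circ> inv q"
    using conjugation_of_cycle[of c q] Cons.prems assms(2) by simp
  ultimately show ?case
    using Cons by (simp add: perm_of_Cons fun_eq_iff)
qed

lemma perm_of_switch:
  "distinct (concat W) \<Longrightarrow>
    perm_of (switch x y W) w = transpose x y (perm_of W (transpose x y w))"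
  unfolding switch_def by (simp add: perm_of_map_conj)

lemma nth_switch: "i < length W \<Longrightarrow> switch x y W ! i = map (transpose x y) (W ! i)"
  by (simp add: switch_def)

lemma concat_switch: "concat (switch x y W) = map (transpose x y) (concat W)"
  by (simp add: switch_def map_concat)


section \<open>Switching adjacent values preserves weak excedances\<close>

definition adjacent :: "nat \<Rightarrow> nat \<Rightarrow> bool" where
  "adjacent x y \<longleftrightarrow> x = Suc y \<or> y = Suc x"

lemma adjacent_int: "\<bar>int x - int y\<bar> = 1 \<longleftrightarrow> adjacent x y"
  unfolding adjacent_def by linarith

text \<open>Interchanging two neighbouring values reverses the order of these two only. Hence first
  entries stay maximal under a switch across blocks.\<close>

lemma transpose_adjacent_mono:
  assumes "adjacent x y" "\<not> {x, y} \<subseteq> {d, e}" "d \<le> e"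
  shows "transpose x y d \<le> transpose x y e"
  using assms unfolding adjacent_def transpose_def by auto

text \<open>No value lies strictly between \<open>x\<close> and \<open>y\<close>, so a third value
  \<open>w\<close> compares equally with both.\<close>

lemma le_transpose_adjacent:
  assumes "adjacent x y" "w \<noteq> x" "w \<noteq> y"
  shows "w \<le> transpose x y v \<longleftrightarrow> w \<le> v"
  using assms unfolding adjacent_def transpose_def by auto

text \<open>For step (II), where \<open>f x\<close> and \<open>f y\<close> are the pair switched
  before. The new images of \<open>x\<close> and \<open>y\<close> are \<open>f y\<close> and
  \<open>f x\<close>, and each of the two points compares equally with both images.\<close>

lemma weak_excedances_conj_parallel:
  assumes "adjacent x y" "adjacent (f x) (f y)" "{f x, f y} \<inter> {x, y} = {}"
  shows "weak_excedances n (transpose x y \<circ> f \<circ> transpose x y) = weak_excedances n f"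
proof -
  have "w \<le> transpose x y (f (transpose x y w)) \<longleftrightarrow> w \<le> f w" for w
  proof (cases "w = x \<or> w = y")
    case True
    moreover have "transpose x y (f x) = f x" "transpose x y (f y) = f y"
      using assms(3) by auto
    ultimately show ?thesis
      using assms unfolding adjacent_def by auto
  qed (use assms in \<open>simp add: le_transpose_adjacent\<close>)
  then show ?thesis
    by (simp add: weak_excedances_def)
qed

text \<open>For step (I): \<open>x\<close> and \<open>y\<close> are weak excedances before and
  after. If \<open>f x = y = Suc x\<close>, the new permutation would send \<open>y\<close> down to
  \<open>x\<close>; the last hypothesis excludes this.\<close>

lemma weak_excedances_conj_increasing:
  assumes "adjacent x y" "x \<le> f x" "f x < f y" "f x \<noteq> y"
  shows "weak_excedances n (transpose x y \<circ> f \<circ> transpose x y) = weak_excedances n f"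
proof -
  have "w \<le> transpose x y (f (transpose x y w)) \<longleftrightarrow> w \<le> f w" for w
  proof (cases "w = x \<or> w = y")
    case True
    then show ?thesis
      using assms unfolding adjacent_def transpose_def by auto
  qed (use assms in \<open>simp add: le_transpose_adjacent\<close>)
  then show ?thesis
    by (simp add: weak_excedances_def)
qed


section \<open>The invariant of the algorithm\<close>

text \<open>\<open>E\<close> and \<open>\<beta>\<close> will be the weak excedances of
  \<open>\<pi>\<close> in \<open>{1..n}\<close> and the preimage of \<open>n + 1\<close>, so the
  last two conjuncts carry the two claims of the theorem through the algorithm.\<close>

definition good_form :: "nat \<Rightarrow> nat set \<Rightarrow> nat \<Rightarrow> nat list list \<Rightarrow> bool" where
  "good_form n E \<beta> W \<longleftrightarrow>
     distinct (concat W) \<and> set (concat W) = {1..n} \<and>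
     (\<forall>c\<in>set W. c \<noteq> [] \<and> (\<forall>e\<in>set c. e \<le> hd c)) \<and>
     weak_excedances n (perm_of W) = E \<and> perm_of W \<beta> = n"

text \<open>\<open>sep\<close> keeps first entries maximal, and \<open>fixed\<close> keeps
  \<open>n\<close> as the image of \<open>\<beta>\<close>. \<open>exc\<close> is a hypothesis
  because steps (I) and (II) satisfy it for different reasons.\<close>

lemma good_form_switch:
  assumes good: "good_form n E \<beta> W" and adj: "adjacent x y"
    and range: "x \<in> {1..n}" "y \<in> {1..n}"
    and sep: "\<And>c. c \<in> set W \<Longrightarrow> \<not> {x, y} \<subseteq> set c"
    and fixed: "n \<notin> {x, y}" "\<beta> \<notin> {x, y}"
    and exc: "weak_excedances n (transpose x y \<circ> perm_of W \<circ> transpose x y) =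
      weak_excedances n (perm_of W)"
  shows "good_form n E \<beta> (switch x y W)"
proof -
  have dist: "distinct (concat W)" and set: "set (concat W) = {1..n}"
    and hd: "\<And>c e. c \<in> set W \<Longrightarrow> e \<in> set c \<Longrightarrow> e \<le> hd c"
    and ne: "\<And>c. c \<in> set W \<Longrightarrow> c \<noteq> []"
    and E: "weak_excedances n (perm_of W) = E" and \<beta>: "perm_of W \<beta> = n"
    using good by (auto simp: good_form_def)
  have "perm_of (switch x y W) = transpose x y \<circ> perm_of W \<circ> transpose x y"
    using perm_of_switch[OF dist] by (simp add: fun_eq_iff)
  moreover have "c \<noteq> [] \<and> (\<forall>e\<in>set c. e \<le> hd c)" if c: "c \<in> set (switch x y W)" for c
  proof -
    obtain d where d: "d \<in> set W" "c = map (transpose x y) d"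
      using c by (auto simp: switch_def)
    have "transpose x y e \<le> transpose x y (hd d)" if "e \<in> set d" for e
    proof (rule transpose_adjacent_mono[OF adj _ hd[OF d(1) that]])
      have "{e, hd d} \<subseteq> set d" using that ne[OF d(1)] by auto
      then show "\<not> {x, y} \<subseteq> {e, hd d}" using sep[OF d(1)] by auto
    qed
    then show ?thesis using ne[OF d(1)] d(2) by (simp add: hd_map)
  qed
  moreover have "set (concat (switch x y W)) = {1..n}"
    using range set permutes_image[OF permutes_swap_id[OF range]]
    unfolding concat_switch by (metis set_map)
  moreover have "distinct (concat (switch x y W))"
    unfolding concat_switch using dist by (simp add: distinct_map)
  moreover have "perm_of (switch x y W) \<beta> = n"
    using \<beta> fixed perm_of_switch[OF dist] by auto
  ultimately show ?thesis
    using E exc unfolding good_form_def by simp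
qed

lemma distinct_concat_unique:
  "distinct (concat W) \<Longrightarrow> c \<in> set W \<Longrightarrow> d \<in> set W \<Longrightarrow> x \<in> set c \<Longrightarrow> x \<in> set d \<Longrightarrow> c = d"
  by (induction W) auto

lemma inj_perm_of: "perm_of W x = perm_of W y \<longleftrightarrow> x = y"
  using permutes_inj[OF perm_of_permutes] by (simp add: inj_eq)

text \<open>Predecessors are preimages under an injective map. This evaluates the \<open>THE\<close>
  terms of \<open>switch_preceding\<close>.\<close>

lemma the_precedes:
  "distinct (concat W) \<Longrightarrow> precedes W s t \<Longrightarrow> (THE s. precedes W s t) = s"
  by (rule the_equality) (metis perm_of_precedes inj_perm_of)+


section \<open>The loops\<close>

text \<open>
  The condition on \<open>hd (W ! i)\<close> keeps the value \<open>n\<close> from being switched: all entries of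
  block \<open>i\<close> stay below \<open>n - 1\<close> until its first entry is switched, which ends the loop.
\<close>

definition chain_state ::
  "nat \<Rightarrow> nat set \<Rightarrow> nat \<Rightarrow> nat \<Rightarrow> nat \<Rightarrow> nat \<Rightarrow> nat list list \<times> nat \<times> nat \<Rightarrow> bool" where
  "chain_state n E \<beta> r i l = (\<lambda>(W, u, v).
     good_form n E \<beta> W \<and> length W = r \<and> i < r \<and> last (W ! i) = l \<and>
     adjacent u v \<and> (u \<in> set (W ! i)) \<noteq> (v \<in> set (W ! i)) \<and> n \<notin> {u, v} \<and>
     (Suc (hd (W ! i)) < n \<or> hd (W ! i) \<in> {u, v}))"

section \<open>One switch of step (II)\<close>

lemma chain_state_commute:
  "chain_state n E \<beta> r i l (W, u, v) \<longleftrightarrow> chain_state n E \<beta> r i l (W, v, u)"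
  by (auto simp: chain_state_def adjacent_def)

text \<open>The case where \<open>u\<close> is the switched entry in block \<open>i\<close>. The
  length counts the entries of that block before the switched pair, the termination measure of step
  (II).\<close>

lemma chain_state_step_aux:
  assumes state: "chain_state n E \<beta> r i l (W, u, v)" and u: "u \<in> set (W ! i)"
    and hd: "hd (W ! i) \<notin> {u, v}"
    and prec: "precedes W x u" "precedes W y v" and adj: "adjacent x y"
  shows "chain_state n E \<beta> r i l (switch x y W, x, y)"
    and "length (takeWhile (\<lambda>e. e \<notin> {x, y}) (switch x y W ! i)) <
      length (takeWhile (\<lambda>e. e \<notin> {u, v}) (W ! i))"
proof -
  let ?c = "W ! i" and ?T = "transpose x y"
  have good: "good_form n E \<beta> W" and i: "i < length W" "length W = r" and l: "last ?c = l"
    and uv: "adjacent u v" "n \<notin> {u, v}" and v: "v \<notin> set ?c" and small: "Suc (hd ?c) < n"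
    using state u hd by (auto simp: chain_state_def)
  have dist: "distinct (concat W)" and set: "set (concat W) = {1..n}"
    and max: "\<And>c e. c \<in> set W \<Longrightarrow> e \<in> set c \<Longrightarrow> e \<le> hd c"
    and \<beta>: "perm_of W \<beta> = n"
    using good by (auto simp: good_form_def)
  have c: "?c \<in> set W" using i by simp
  obtain ps ss where split: "?c = ps @ [x, u] @ ss"
    using prec(1) distinct_concat_unique[OF dist c _ u]
    unfolding precedes_def sublist_def by fastforce
  then have c_ne: "?c \<noteq> []" by simp
  have dc: "distinct (ps @ [x, u] @ ss)"
    using split distinct_concat_member[OF dist c] by simp
  obtain d where d: "d \<in> set W" "y \<in> set d" "v \<in> set d" "y \<noteq> v"
    using prec(2) distinct_concat_member[OF dist]
    unfolding precedes_def sublist_def by fastforce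
  \<comment> \<open>\<open>y\<close> shares its block with \<open>v\<close>, which lies outside
    block \<open>i\<close>.\<close>
  have y: "y \<notin> set ?c"
    using distinct_concat_unique[OF dist c d(1) _ d(2)] d(3) v by blast
  have x: "x \<in> set ?c" using split by simp
  have fx: "perm_of W x = u" "perm_of W y = v"
    using perm_of_precedes[OF dist] prec by auto
  have disj: "{u, v} \<inter> {x, y} = {}"
    using dc d(4) u v x y by auto
  have "good_form n E \<beta> (switch x y W)"
  proof (rule good_form_switch[OF good adj])
    show "x \<in> {1..n}" "y \<in> {1..n}"
      using c x d set by auto
    show "\<not> {x, y} \<subseteq> set c" if "c \<in> set W" for c
      using distinct_concat_unique[OF dist c that x] y by auto
    \<comment> \<open>\<open>x\<close> is at most \<open>n - 2\<close>, so its neighbour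
      \<open>y\<close> is at most \<open>n - 1\<close>.\<close>
    show "n \<notin> {x, y}"
      using max[OF c x] small adj by (auto simp: adjacent_def)
    show "\<beta> \<notin> {x, y}"
      using \<beta> fx uv(2) by auto
    show "weak_excedances n (?T \<circ> perm_of W \<circ> ?T) = weak_excedances n (perm_of W)"
      by (rule weak_excedances_conj_parallel) (use adj uv disj fx in auto)
  qed
  moreover have "n \<notin> {x, y}"
    using max[OF c x] small adj by (auto simp: adjacent_def)
  moreover have c': "switch x y W ! i = map ?T ?c"
    using i by (simp add: nth_switch)
  moreover have "last (map ?T ?c) = l"
  proof -
    \<comment> \<open>The last entry is \<open>u\<close> or further right, hence past
      \<open>x\<close>, while \<open>y\<close> is in another block.\<close>
    have "last ?c \<in> set (u # ss)" by (simp add: split)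
    then have "last ?c \<noteq> x" "last ?c \<noteq> y"
      using dc y by (auto simp: split)
    then have "?T (last ?c) = last ?c" by simp
    then show ?thesis using l c_ne by (simp add: last_map)
  qed
  moreover have "y \<in> set (map ?T ?c)" "x \<notin> set (map ?T ?c)"
    using x y by (simp_all add: in_transpose_image_iff)
  moreover have "Suc (hd (map ?T ?c)) < n \<or> hd (map ?T ?c) \<in> {x, y}"
    using small c_ne by (auto simp: hd_map transpose_def)
  ultimately show "chain_state n E \<beta> r i l (switch x y W, x, y)"
    using adj i by (auto simp: chain_state_def switch_def)
  have ps: "map ?T ps = ps"
    using dc y by (intro map_idI) (auto simp: split transpose_def)
  \<comment> \<open>After the switch \<open>y\<close> stands in the place of \<open>x\<close>, one
    position to the left of \<open>u\<close>.\<close>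
  have "takeWhile (\<lambda>e. e \<notin> {x, y}) (map ?T ?c) = ps"
    using dc y by (subst split) (auto simp: split ps takeWhile_tail)
  moreover have "takeWhile (\<lambda>e. e \<notin> {u, v}) ?c = ps @ [x]"
    using dc v by (subst split, subst takeWhile_append2) (auto simp: split)
  ultimately show "length (takeWhile (\<lambda>e. e \<notin> {x, y}) (switch x y W ! i)) <
      length (takeWhile (\<lambda>e. e \<notin> {u, v}) (W ! i))"
    using c' by simp
qed

lemma switch_commute: "switch u v W = switch v u W"
  by (simp add: switch_def transpose_commute)

text \<open>Exactly one of \<open>u\<close> and \<open>v\<close> is in block \<open>i\<close>;
  interchanging \<open>u\<close>, \<open>x\<close> with \<open>v\<close>, \<open>y\<close> reduces
  the second case to the first.\<close>

lemma chain_state_step: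
  assumes state: "chain_state n E \<beta> r i l (W, u, v)"
    and hd: "hd (W ! i) \<notin> {u, v}"
    and prec: "precedes W x u" "precedes W y v" and adj: "adjacent x y"
  shows "chain_state n E \<beta> r i l (switch x y W, x, y) \<and>
    length (takeWhile (\<lambda>e. e \<notin> {x, y}) (switch x y W ! i)) <
      length (takeWhile (\<lambda>e. e \<notin> {u, v}) (W ! i))"
proof (cases "u \<in> set (W ! i)")
  case True
  then show ?thesis
    using chain_state_step_aux[OF state True hd prec adj] by simp
next
  case False
  have *: "chain_state n E \<beta> r i l (W, v, u)" "v \<in> set (W ! i)" "hd (W ! i) \<notin> {v, u}"
    "adjacent y x"
    using state False hd adj chain_state_commute by (auto simp: chain_state_def adjacent_def)
  show ?thesis
    using chain_state_step_aux[OF *(1-3) prec(2,1) *(4)]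
    by (simp add: chain_state_commute[of n E \<beta> r i l _ y x] switch_commute[of y x]
      insert_commute conj_commute)
qed

lemma chain_state_switch_preceding:
  assumes "chain_state n E \<beta> r i l s"
  shows "chain_state n E \<beta> r i l (switch_preceding i s)"
proof -
  let ?r = "measure (\<lambda>(W, u, v). length (takeWhile (\<lambda>e. e \<notin> {u, v}) (W ! i)))"
  show ?thesis unfolding switch_preceding_def
  proof (rule while_rule2[where P = "chain_state n E \<beta> r i l" and r = ?r])
    fix s
    assume state: "chain_state n E \<beta> r i l s"
      and guard: "case s of (W, u, v) \<Rightarrow> hd (W ! i) \<notin> {u, v} \<and>
        (\<exists>x y. precedes W x u \<and> precedes W y v \<and> \<bar>int x - int y\<bar> = 1)"
    obtain W u v where s: "s = (W, u, v)" by (cases s)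
    obtain x y where xy: "precedes W x u" "precedes W y v" "adjacent x y"
      and hd: "hd (W ! i) \<notin> {u, v}"
      using guard by (auto simp: s adjacent_int)
    have "distinct (concat W)"
      using state by (simp add: s chain_state_def good_form_def)
    then have "(THE x. precedes W x u) = x" "(THE y. precedes W y v) = y"
      using xy by (simp_all add: the_precedes)
    then show "chain_state n E \<beta> r i l
        (case s of (W, u, v) \<Rightarrow>
          let x = (THE x. precedes W x u); y = (THE y. precedes W y v)
          in (switch x y W, x, y)) \<and>
      (case s of (W, u, v) \<Rightarrow>
          let x = (THE x. precedes W x u); y = (THE y. precedes W y v)
          in (switch x y W, x, y), s) \<in> ?r"
      using chain_state_step[OF state[unfolded s] hd xy] by (simp add: s Let_def)
  qed (use assms in auto)
qed

text \<open>Step (I) yields a starting state for step (II). As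
  \<open>p z' < p z \<le> p \<beta>\<close>, the entry \<open>z'\<close> is not
  \<open>\<beta>\<close>, so its image is below \<open>n\<close>.\<close>

lemma cond_P_step:
  assumes good: "good_form n E \<beta> W" and i: "i < length W" and z: "last (W ! i) = z"
    and P: "cond_P n p W z z'" and adj: "adjacent z z'"
    and p: "p z \<le> p \<beta>"
  shows "chain_state n E \<beta> (length W) i z' (switch z z' W, z, z')"
proof -
  let ?c = "W ! i" and ?T = "transpose z z'"
  have dist: "distinct (concat W)" and set: "set (concat W) = {1..n}"
    and max: "\<And>c e. c \<in> set W \<Longrightarrow> e \<in> set c \<Longrightarrow> e \<le> hd c"
    and ne: "\<And>c. c \<in> set W \<Longrightarrow> c \<noteq> []"
    and \<beta>: "perm_of W \<beta> = n"
    using good by (auto simp: good_form_def)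
  have c: "?c \<in> set W" and c_ne: "?c \<noteq> []" using i ne by auto
  have zc: "z \<in> set ?c" using z c_ne by auto
  have fz: "perm_of W z = hd ?c" using perm_of_last[OF dist c c_ne] z by simp
  have range: "z \<in> {1..n}" "z' \<in> {1..n}" and less: "perm_of W z < perm_of W z'"
    and "p z' < p z"
    using P by (auto simp: cond_P_def)
  \<comment> \<open>Entries of block \<open>i\<close> have images in that block, at most
    \<open>hd ?c\<close>, which is the image of \<open>z\<close>.\<close>
  have z'c: "z' \<notin> set ?c"
    using max[OF c perm_of_in[OF dist c]] less fz by force
  have z'\<beta>: "z' \<noteq> \<beta>" using p \<open>p z' < p z\<close> by auto
  then have "perm_of W z' \<noteq> n" using \<beta> inj_perm_of by metis
  moreover have "perm_of W z' \<le> n"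
    using permutes_in_image[OF perm_of_permutes[of W]] range(2) unfolding set by (metis atLeastAtMost_iff)
  ultimately have small: "Suc (hd ?c) < n" using less fz by linarith
  have fixed: "n \<notin> {z, z'}"
    using max[OF c zc] small adj by (auto simp: adjacent_def)
  have "good_form n E \<beta> (switch z z' W)"
  proof (rule good_form_switch[OF good adj range _ fixed])
    show "\<not> {z, z'} \<subseteq> set c" if "c \<in> set W" for c
      using distinct_concat_unique[OF dist c that zc] z'c by auto
    show "\<beta> \<notin> {z, z'}" using z'\<beta> \<beta> fz small by auto
    show "weak_excedances n (?T \<circ> perm_of W \<circ> ?T) = weak_excedances n (perm_of W)"
      by (rule weak_excedances_conj_increasing)
        (use adj less fz max[OF c zc] z'c c_ne in auto)
  qed
  moreover have "last (map ?T ?c) = z'" using c_ne z by (simp add: last_map)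
  moreover have "z' \<in> set (map ?T ?c)" "z \<notin> set (map ?T ?c)"
    using zc z'c by (simp_all add: in_transpose_image_iff)
  moreover have "Suc (hd (map ?T ?c)) < n \<or> hd (map ?T ?c) \<in> {z, z'}"
    using small c_ne by (auto simp: hd_map transpose_def)
  moreover have "switch z z' W ! i = map ?T ?c" using i by (simp add: nth_switch)
  ultimately show ?thesis
    using adj i fixed by (auto simp: chain_state_def switch_def)
qed

section \<open>The outer loop and the iterations\<close>

lemma adjacent_shift: "\<epsilon> \<in> {-1, 1} \<Longrightarrow> 1 \<le> z \<Longrightarrow> adjacent z (shift z \<epsilon>)"
  by (auto simp: adjacent_def shift_def)

lemma good_form_switch_loop:
  assumes good: "good_form n E \<beta> W" and i: "i < length W" and z: "last (W ! i) = z"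
    and \<epsilon>: "\<epsilon> \<in> {-1, 1}" and p: "\<And>x. x \<in> {1..n} \<Longrightarrow> p x \<le> p \<beta>"
  shows "good_form n E \<beta> (fst (switch_loop n p i \<epsilon> (W, z))) \<and>
    length (fst (switch_loop n p i \<epsilon> (W, z))) = length W"
proof -
  \<comment> \<open>\<open>z\<close> moves one step in direction \<open>\<epsilon>\<close> and stays
    in \<open>{1..n}\<close>.\<close>
  let ?r = "measure (\<lambda>(W, z). if \<epsilon> = 1 then n - z else z)"
  let ?P = "\<lambda>(W', z). good_form n E \<beta> W' \<and> length W' = length W \<and> last (W' ! i) = z"
  let ?Q = "\<lambda>s. good_form n E \<beta> (fst s) \<and> length (fst s) = length W"
  have "?Q (switch_loop n p i \<epsilon> (W, z))" unfolding switch_loop_def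
  proof (rule while_rule2[where P = ?P and r = ?r])
    fix s
    assume state: "?P s" and guard: "case s of (W, z) \<Rightarrow> cond_P n p W z (shift z \<epsilon>)"
    obtain W' z where s: "s = (W', z)" by (cases s)
    let ?z = "shift z \<epsilon>"
    have P: "cond_P n p W' z ?z" using guard s by simp
    then have range: "z \<in> {1..n}" "?z \<in> {1..n}" by (auto simp: cond_P_def)
    then have adj: "adjacent z ?z" using adjacent_shift[OF \<epsilon>] by simp
    have "chain_state n E \<beta> (length W') i ?z (switch z ?z W', z, ?z)"
      using state i P adj p[OF range(1)] by (intro cond_P_step) (auto simp: s)
    from chain_state_switch_preceding[OF this]
    have "?P (fst (switch_preceding i (switch z ?z W', z, ?z)), ?z)"
      using state by (auto simp: s chain_state_def split: prod.splits)
    moreover have "((fst (switch_preceding i (switch z ?z W', z, ?z)), ?z), s) \<in> ?r"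
      using range \<epsilon> by (auto simp: s shift_def)
    ultimately show "?P (case s of (W, z) \<Rightarrow>
          let z' = shift z \<epsilon> in (fst (switch_preceding i (switch z z' W, z, z')), z')) \<and>
      (case s of (W, z) \<Rightarrow>
          let z' = shift z \<epsilon> in (fst (switch_preceding i (switch z z' W, z, z')), z'), s) \<in> ?r"
      by (simp add: s Let_def)
  qed (use good z in auto)
  then show ?thesis .
qed

lemma good_form_iteration:
  assumes good: "good_form n E \<beta> W" and i: "i < length W"
    and p: "\<And>x. x \<in> {1..n} \<Longrightarrow> p x \<le> p \<beta>"
  shows "good_form n E \<beta> (iteration n p i W) \<and> length (iteration n p i W) = length W"
proof -
  let ?z = "last (W ! i)"
  let ?C = "\<lambda>\<epsilon>. \<epsilon> \<in> {-1, 1} \<and> cond_P n p W ?z (shift ?z \<epsilon>)"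
  let ?g = "\<lambda>\<epsilon>. perm_of W (shift ?z \<epsilon>)"
  show ?thesis
  proof (cases "cond_P n p W ?z (?z + 1) \<or> cond_P n p W ?z (?z - 1)")
    case True
    \<comment> \<open>At \<open>?z = 0\<close> both \<open>nat\<close> and the subtraction truncate
      to 0.\<close>
    have "shift ?z 1 = ?z + 1" "shift ?z (-1) = ?z - 1"
      by (auto simp: shift_def)
    then have "?C 1 \<or> ?C (-1)" using True by auto
    then obtain \<epsilon> where "?C \<epsilon>" by blast
    moreover have "\<forall>\<epsilon>. ?C \<epsilon> \<longrightarrow> ?g \<epsilon> < Suc (max (?g 1) (?g (-1)))"
      by auto
    ultimately have "?C (arg_max ?g ?C)" by (rule arg_max_natI)
    then show ?thesis
      using good_form_switch_loop[where p = p, OF good i refl _ p] True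
      by (auto simp: iteration_def Let_def)
  qed (use good in \<open>simp add: iteration_def Let_def\<close>)
qed

lemma good_form_fold_iteration:
  assumes "good_form n E \<beta> W" "\<And>x. x \<in> {1..n} \<Longrightarrow> p x \<le> p \<beta>"
    "\<And>i. i \<in> set is \<Longrightarrow> i < length W"
  shows "good_form n E \<beta> (fold (iteration n p) is W)"
  using assms
proof (induction "is" arbitrary: W)
  case (Cons i "is")
  then show ?case
    using good_form_iteration[of n E \<beta> W i p] by simp
qed simp


section \<open>The initial form\<close>

text \<open>Consecutive index intervals abut, so the concatenation telescopes.\<close>

lemma concat_blocks:
  assumes "sorted_wrt (<) ks" "m < length ks"
  shows "concat (map (\<lambda>j. map f [ks ! j..<ks ! Suc j]) [0..<m]) = map f [ks ! 0..<ks ! m]"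
  using assms(2)
proof (induction m)
  case (Suc m)
  have "ks ! 0 \<le> ks ! m"
    using sorted_wrt_nth_less[OF assms(1), of 0 m] Suc.prems by (cases m) auto
  moreover have "ks ! m \<le> ks ! Suc m"
    using sorted_wrt_nth_less[OF assms(1), of m "Suc m"] Suc.prems by auto
  ultimately have "[ks ! 0..<ks ! Suc m] = [ks ! 0..<ks ! m] @ [ks ! m..<ks ! Suc m]"
    by (metis le_add_diff_inverse upt_add_eq_append)
  then show ?case using Suc by simp
qed simp

lemma cycle_word_nth:
  "k < m \<Longrightarrow> cycle_word m p ! k = (p ^^ Suc k) m"
  by (simp add: cycle_word_def del: upt_Suc funpow.simps)

lemma cycle_word_nth_top:
  assumes "p \<in> cyclic_perms (n + 1)"
  shows "cycle_word (n + 1) p ! n = n + 1"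
proof -
  let ?t = "cycle_word (n + 1) p"
  have len: "length ?t = n + 1" by (simp add: cycle_word_def)
  then have "?t \<noteq> []" by auto
  from last_conv_nth[OF this] show ?thesis
    using cycle_word(3)[OF assms] len by simp
qed

text \<open>The witness is \<open>t ! (n - 1)\<close>, the entry before \<open>n + 1\<close> in the
  word and the last entry of the last block. Both permutations agree except at the ends of
  blocks.\<close>

lemma good_form_initial_form:
  assumes n: "n \<ge> 1" and \<pi>: "\<pi> \<in> cyclic_perms (n + 1)"
  shows "\<exists>\<beta>. \<pi> \<beta> = n + 1 \<and>
    good_form n (weak_excedances n \<pi>) \<beta> (initial_form n \<pi>)"
proof -
  define t where "t = cycle_word (n + 1) \<pi>"
  define ks where "ks = lr_maxima t"
  define r where "r = length ks - 1"
  define B where "B = (\<lambda>j. map ((!) t) [ks ! j..<ks ! Suc j])"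
  define W where "W = initial_form n \<pi>"
  have W: "W = map B [0..<r]"
    by (simp add: W_def initial_form_def Let_def B_def r_def ks_def t_def)
  have t: "distinct t" "set t = {1..n + 1}"
    using cycle_word[OF \<pi>] by (simp_all add: t_def)
  have len: "length t = n + 1" by (simp add: t_def cycle_word_def)
  have tn: "t ! n = n + 1"
    using cycle_word_nth_top[OF \<pi>] by (simp add: t_def)
  have nxt: "\<pi> (t ! k) = t ! Suc k" if "k < n" for k
    using that by (simp add: t_def cycle_word_nth)
  have t_le: "t ! k \<in> {1..n}" if "k < n" for k
  proof -
    have "t ! k \<in> {1..n + 1}" using that len t(2) nth_mem[of k t] by simp
    moreover have "t ! k \<noteq> t ! n" using that len t(1) by (simp add: nth_eq_iff_index_eq)
    ultimately show ?thesis using tn by auto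
  qed
  have t_all: "\<exists>k<n. x = t ! k" if "x \<in> {1..n}" for x
  proof -
    have "x \<in> set t" using that t(2) by auto
    then obtain k where "k < n + 1" "x = t ! k" using len by (metis in_set_conv_nth)
    moreover have "k \<noteq> n" using that tn calculation by auto
    ultimately show ?thesis by (intro exI[of _ k]) simp
  qed
  have ks: "sorted_wrt (<) ks" "set ks = {k. k \<le> n \<and> (\<forall>j<k. t ! j < t ! k)}"
    unfolding ks_def lr_maxima_def using len
    by (auto simp: sorted_wrt_filter less_Suc_eq_le simp del: upt_Suc)
  note ks_less = sorted_wrt_nth_less[OF ks(1)]
  \<comment> \<open>Index 0 qualifies vacuously, index \<open>n\<close> because it carries
    \<open>n + 1\<close>; so \<open>ks\<close> runs from 0 to \<open>n\<close>.\<close>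
  have "0 \<in> set ks" "n \<in> set ks" using ks(2) t_le tn by force+
  then obtain a b where ab: "a < length ks" "ks ! a = 0" "b < length ks" "ks ! b = n"
    by (metis in_set_conv_nth)
  have "a = 0" using ks_less[of 0 a] ab by (cases a) auto
  then have ks0: "ks ! 0 = 0" using ab by simp
  have "b = r"
  proof (rule ccontr)
    assume "b \<noteq> r"
    then have "n < ks ! Suc b" "Suc b < length ks"
      using ks_less[of b "Suc b"] ab by (auto simp: r_def)
    then show False using ks(2) nth_mem[of "Suc b" ks] by auto
  qed
  then have ksr: "ks ! r = n" and lenks: "length ks = Suc r" using ab by (auto simp: r_def)
  have r: "r \<ge> 1" using ks0 ksr n by (cases r) auto
  have step: "ks ! j < ks ! Suc j" "ks ! Suc j \<le> n" if "j < r" for j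
    using that ks_less[of j "Suc j"] lenks nth_mem[of "Suc j" ks] ks(2) by auto
  have lr: "t ! m < t ! (ks ! j)" if "j \<le> r" "m < ks ! j" for j m
    using that nth_mem[of j ks] lenks ks(2) by auto
  \<comment> \<open>The first entry to exceed \<open>t ! (ks ! j)\<close> would be a left-to-right
    maximum strictly between two consecutive ones.\<close>
  have max: "t ! k \<le> t ! (ks ! j)" if "j < r" "k < ks ! Suc j" for j k
    using that(2)
  proof (induction k rule: less_induct)
    case (less k)
    show ?case
    proof (rule ccontr)
      assume "\<not> ?thesis"
      then have gt: "t ! (ks ! j) < t ! k" by simp
      then have "ks ! j < k" using lr[of j k] that(1) by (metis less_asym' less_imp_le nat_neq_iff)
      have "k \<in> set ks"
        using ks(2) less gt step(2)[OF that(1)] by force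
      then obtain m where m: "m < length ks" "k = ks ! m" by (metis in_set_conv_nth)
      have "j < m" using m \<open>ks ! j < k\<close> ks_less[of m j] that(1) lenks
        by (metis less_asym' less_SucI nat_neq_iff)
      moreover have "m < Suc j" using m less.prems ks_less[of "Suc j" m]
        by (metis less_asym' nat_neq_iff)
      ultimately show False by simp
    qed
  qed
  have concat: "concat W = map ((!) t) [0..<n]"
    using concat_blocks[OF ks(1), of r "(!) t"] lenks ks0 ksr by (simp add: W B_def)
  have dist: "distinct (concat W)"
    unfolding concat distinct_map using t(1) len by (auto simp: inj_on_def nth_eq_iff_index_eq)
  have set: "set (concat W) = {1..n}"
    unfolding concat using t_le t_all by (fastforce simp: image_iff)
  have hdB: "B j \<noteq> [] \<and> hd (B j) = t ! (ks ! j) \<and> last (B j) = t ! (ks ! Suc j - 1)"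
    if "j < r" for j
    using step(1)[OF that] by (simp add: B_def hd_map last_map)
  have inB: "\<exists>k. ks ! j \<le> k \<and> k < ks ! Suc j \<and> x = t ! k" if "x \<in> set (B j)" for x j
    using that by (auto simp: B_def)
  have W_mem: "B j \<in> set W" if "j < r" for j using that by (auto simp: W)
  have perm_inner: "perm_of W (t ! k) = t ! Suc k"
    if "j < r" "ks ! j \<le> k" "Suc k < ks ! Suc j" for j k
  proof -
    have "[ks ! j..<ks ! Suc j] = [ks ! j..<k] @ [k..<ks ! Suc j]"
      using that by (metis le_add_diff_inverse less_imp_le_nat Suc_lessD upt_add_eq_append)
    also have "[k..<ks ! Suc j] = [k, Suc k] @ [Suc (Suc k)..<ks ! Suc j]"
      using that by (simp add: upt_conv_Cons)
    finally have "B j = map ((!) t) [ks ! j..<k] @ [t ! k, t ! Suc k] @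
        map ((!) t) [Suc (Suc k)..<ks ! Suc j]"
      by (simp add: B_def)
    then show ?thesis using perm_of_consecutive[OF dist] W_mem[OF that(1)] by metis
  qed
  have perm_last: "perm_of W (t ! (ks ! Suc j - 1)) = t ! (ks ! j)" if "j < r" for j
    using perm_of_last[OF dist W_mem[OF that]] hdB[OF that] by simp
  have "x \<le> perm_of W x \<longleftrightarrow> x \<le> \<pi> x" if "x \<in> {1..n}" for x
  proof -
    have "x \<in> set (concat W)" using that set by simp
    then obtain j where j: "j < r" "x \<in> set (B j)" by (auto simp: W)
    then obtain k where k: "ks ! j \<le> k" "k < ks ! Suc j" "x = t ! k" using inB by blast
    have kn: "k < n" using k(2) step(2)[OF j(1)] by simp
    show ?thesis
    proof (cases "Suc k < ks ! Suc j")
      case True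
      then show ?thesis using perm_inner[OF j(1) k(1)] nxt[OF kn] k(3) by simp
    next
      case False
      then have eq: "Suc k = ks ! Suc j" using k(2) by simp
      then have "perm_of W x = t ! (ks ! j)" using perm_last[OF j(1)] k(3) by (metis diff_Suc_1)
      then have "x \<le> perm_of W x" using max[OF j(1) k(2)] k(3) by simp
      \<comment> \<open>\<open>\<pi>\<close> sends the end of a block to the next left-to-right
        maximum, which is \<open>n + 1\<close> for the last block.\<close>
      moreover have "x < \<pi> x" using lr[of "Suc j" k] j(1) eq nxt[OF kn] k by simp
      ultimately show ?thesis by simp
    qed
  qed
  then have "weak_excedances n (perm_of W) = weak_excedances n \<pi>"
    by (auto simp: weak_excedances_def)
  \<comment> \<open>The first entry of the last block bounds all of \<open>t ! 0\<close> to
    \<open>t ! (n - 1)\<close>, so it is \<open>n\<close>.\<close>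
  moreover have "perm_of W (t ! (n - 1)) = n"
  proof -
    obtain q where q: "r = Suc q" using r by (cases r) auto
    have top: "t ! (ks ! q) \<in> {1..n}" using t_le step(1)[of q] ksr q by simp
    obtain k where "k < n" "n = t ! k" using t_all[of n] n by auto
    then have "n \<le> t ! (ks ! q)" using max[of q k] q ksr by simp
    then show ?thesis using top perm_last[of q] q ksr by simp
  qed
  moreover have "c \<noteq> [] \<and> (\<forall>e\<in>set c. e \<le> hd c)" if "c \<in> set W" for c
    using that hdB max inB by (fastforce simp: W)
  ultimately have "good_form n (weak_excedances n \<pi>) (t ! (n - 1)) W"
    using dist set by (simp add: good_form_def)
  moreover have "\<pi> (t ! (n - 1)) = n + 1" using nxt[of "n - 1"] n tn by simp
  ultimately show ?thesis unfolding W_def by blast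
qed

text \<open>The first and last entries of the word differ, as its length is at least 2. Hence
  \<open>n + 1\<close> is no weak excedance.\<close>

lemma cyclic_perms_top_not_fixed:
  assumes "n \<ge> 1" "p \<in> cyclic_perms (n + 1)"
  shows "p (n + 1) < n + 1"
proof -
  let ?t = "cycle_word (n + 1) p"
  have t: "distinct ?t" "set ?t = {1..n + 1}"
    using cycle_word[OF assms(2)] by simp_all
  have len: "length ?t = n + 1" by (simp add: cycle_word_def)
  have "?t ! 0 = p (n + 1)" by (simp add: cycle_word_nth)
  moreover have "?t ! n = n + 1" by (rule cycle_word_nth_top[OF assms(2)])
  moreover have "?t ! 0 \<noteq> ?t ! n" using t(1) len assms(1) by (simp add: nth_eq_iff_index_eq)
  moreover have "?t ! 0 \<in> {1..n + 1}" using t(2) len nth_mem[of 0 ?t] by simp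
  ultimately show ?thesis by auto
qed

theorem proposition3p7:
  fixes n :: nat and \<pi> \<sigma> :: "nat \<Rightarrow> nat"
  assumes "n \<ge> 1" and "\<pi> \<in> cyclic_perms (n + 1)" and "\<sigma> = \<phi> n \<pi>"
  shows "inv \<pi> (n + 1) = inv \<sigma> n \<and> weak_excedances (n + 1) \<pi> = weak_excedances n \<sigma>"
proof -
  obtain \<beta> where \<beta>: "\<pi> \<beta> = n + 1"
    and good: "good_form n (weak_excedances n \<pi>) \<beta> (initial_form n \<pi>)"
    using good_form_initial_form[OF assms(1,2)] by blast
  have perm: "\<pi> permutes {1..n + 1}" using assms(2) by (simp add: cyclic_perms_def)
  have le: "\<pi> x \<le> \<pi> \<beta>" if "x \<in> {1..n}" for x
    using that permutes_in_image[OF perm, of x] \<beta> by auto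
  define W where
    "W = fold (iteration n \<pi>) [0..<length (initial_form n \<pi>) - 1] (initial_form n \<pi>)"
  have "\<sigma> = perm_of W" using assms(3) by (simp add: \<phi>_def W_def Let_def)
  moreover have "good_form n (weak_excedances n \<pi>) \<beta> W"
    unfolding W_def by (rule good_form_fold_iteration[where p = \<pi>, OF good le]) auto
  ultimately have \<sigma>: "\<sigma> \<beta> = n" "weak_excedances n \<sigma> = weak_excedances n \<pi>"
    and "inj \<sigma>"
    by (auto simp: good_form_def intro: permutes_inj[OF perm_of_permutes])
  have "inv \<pi> (n + 1) = \<beta>" using \<beta> permutes_inj[OF perm] by (metis inv_f_f)
  moreover have "inv \<sigma> n = \<beta>" using \<sigma>(1) \<open>inj \<sigma>\<close> by (metis inv_f_f)
  moreover have "weak_excedances (n + 1) \<pi> = weak_excedances n \<pi>"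
    using cyclic_perms_top_not_fixed[OF assms(1,2)]
    by (force simp: weak_excedances_def le_Suc_eq)
  ultimately show ?thesis using \<sigma>(2) by simp
qed

end
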